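(* Let $q_x$ and $q_z$ be two members of the same exponential family of probability distributions, with natural parameters $\eta_x$ and $\eta_z$ respectively. Then, for fixed $q_x$, the Kullback–Leibler divergence $\mathrm{KL}(q_x\|q_z)$ is a convex function of the natural parameter $\eta_z$ of $q_z$ (on the natural parameter space of the family).
   Context: An exponential family consists of the distributions with densities, with respect to a fixed base measure, of the form $q(y\mid\eta)=\exp(\langle S(y),\eta\rangle-A(\eta))$, where $S$ is the vector of sufficient statistics, $\eta$ is the natural parameter, and $A$ is the log-partition (cumulant) function; the natural parameter space is the set of $\eta$ with $A(\eta)<\infty$. The Kullback–Leibler divergence is $\mathrm{KL}(q_x\|q_z)=\int q_x\log(q_x/q_z)$, with values in $[0,\infty]$. *)

theory Defs
  imports "HOL-Probability.Probability"
begin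

(* Logarithm with values in [-infinity, infinity]; the library's ln is total with ln 0 = 0. *)
definition ennreal_ln :: "ennreal \<Rightarrow> ereal" where
  "ennreal_ln x = (if x = \<infinity> then \<infinity> else if x = 0 then -\<infinity> else ereal (ln (enn2real x)))"

definition log_partition :: "'a measure \<Rightarrow> ('a \<Rightarrow> 'b::euclidean_space) \<Rightarrow> 'b \<Rightarrow> ereal" where
  "log_partition M S \<eta> = ennreal_ln (\<integral>\<^sup>+ y. ennreal (exp (S y \<bullet> \<eta>)) \<partial>M)"

definition natural_parameter_space :: "'a measure \<Rightarrow> ('a \<Rightarrow> 'b::euclidean_space) \<Rightarrow> 'b set" where
  "natural_parameter_space M S = {\<eta>. log_partition M S \<eta> < \<infinity>}"

(* Only meaningful where the log-partition function is finite: real_of_ereal sends infinity to 0. *)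
definition exp_family_density :: "'a measure \<Rightarrow> ('a \<Rightarrow> 'b::euclidean_space) \<Rightarrow> 'b \<Rightarrow> 'a \<Rightarrow> real" where
  "exp_family_density M S \<eta> y = exp (S y \<bullet> \<eta> - real_of_ereal (log_partition M S \<eta>))"

(* The usual conventions 0 log (0 / b) = 0 and a log (a / 0) = infinity for a > 0. *)
definition kl_integrand :: "real \<Rightarrow> real \<Rightarrow> ereal" where
  "kl_integrand a b = (if a = 0 then 0 else if b = 0 then \<infinity> else ereal (a * ln (a / b)))"

(* The integral of the positive part minus that of the negative part, as e2ennreal truncates
   negative values to 0. For probability densities the second integral is finite. The library's
   KL_divergence is real-valued, hence 0 when the integral diverges. *)
definition kl_div :: "'a measure \<Rightarrow> ('a \<Rightarrow> real) \<Rightarrow> ('a \<Rightarrow> real) \<Rightarrow> ereal" where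
  "kl_div M p q =
     enn2ereal (\<integral>\<^sup>+ y. e2ennreal (kl_integrand (p y) (q y)) \<partial>M)
     - enn2ereal (\<integral>\<^sup>+ y. e2ennreal (- kl_integrand (p y) (q y)) \<partial>M)"

(* The library's convex_on for functions that may take infinite values (0 * infinity = 0 in ereal). *)
definition ereal_convex_on :: "'b::real_vector set \<Rightarrow> ('b \<Rightarrow> ereal) \<Rightarrow> bool" where
  "ereal_convex_on C f \<longleftrightarrow> convex C \<and>
     (\<forall>x\<in>C. \<forall>y\<in>C. \<forall>u\<ge>0. \<forall>v\<ge>0. u + v = 1 \<longrightarrow>
        f (u *\<^sub>R x + v *\<^sub>R y) \<le> ereal u * f x + ereal v * f y)"

lemma ereal_convex_on_real: "ereal_convex_on C (\<lambda>x. ereal (f x)) \<longleftrightarrow> convex_on C f"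
  by (simp add: ereal_convex_on_def convex_on_def)

lemma kl_div_eq_integral:
  assumes "\<And>y. p y > 0" and "\<And>y. q y > 0"
    and int: "integrable M (\<lambda>y. p y * ln (p y / q y))"
  shows "kl_div M p q = ereal (\<integral>y. p y * ln (p y / q y) \<partial>M)"
proof -
  define g where "g = (\<lambda>y. p y * ln (p y / q y))"
  have k: "kl_integrand (p y) (q y) = ereal (g y)" for y
    using assms(1,2)[of y] by (simp add: kl_integrand_def g_def)
  have fin: "(\<integral>\<^sup>+ y. ennreal (g y) \<partial>M) < \<infinity>" "(\<integral>\<^sup>+ y. ennreal (- g y) \<partial>M) < \<infinity>"
    using int by (auto simp: real_integrable_def g_def less_top)
  have e: "enn2ereal x = ereal (enn2real x)" if "x < \<infinity>" for x
    using that by (cases x) auto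
  have "kl_div M p q = enn2ereal (\<integral>\<^sup>+ y. ennreal (g y) \<partial>M) - enn2ereal (\<integral>\<^sup>+ y. ennreal (- g y) \<partial>M)"
    by (simp add: kl_div_def k e2ennreal_ereal)
  also have "\<dots> = ereal (enn2real (\<integral>\<^sup>+ y. ennreal (g y) \<partial>M) - enn2real (\<integral>\<^sup>+ y. ennreal (- g y) \<partial>M))"
    by (simp add: e[OF fin(1)] e[OF fin(2)])
  also have "\<dots> = ereal (\<integral>y. g y \<partial>M)"
    using int by (simp add: real_lebesgue_integral_def g_def)
  finally show ?thesis by (simp add: g_def)
qed

lemma prob_space_exp_family_density:
  assumes [measurable]: "S \<in> borel_measurable M" and M: "emeasure M (space M) \<noteq> 0"
    and \<eta>: "\<eta> \<in> natural_parameter_space M S"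
  shows "prob_space (density M (\<lambda>y. ennreal (exp_family_density M S \<eta> y)))"
proof -
  define Z where "Z = (\<integral>\<^sup>+ y. ennreal (exp (S y \<bullet> \<eta>)) \<partial>M)"
  have Zinf: "Z \<noteq> \<infinity>"
    using \<eta> by (auto simp: natural_parameter_space_def log_partition_def ennreal_ln_def Z_def)
  have Z0: "Z \<noteq> 0"
  proof
    assume "Z = 0"
    then have "AE y in M. ennreal (exp (S y \<bullet> \<eta>)) = 0"
      unfolding Z_def by (subst (asm) nn_integral_0_iff_AE) auto
    then have "AE y in M. False" by eventually_elim (auto simp: ennreal_eq_0_iff not_le)
    then show False using M by (auto simp: AE_iff_measurable[OF sets.top])
  qed
  define z where "z = enn2real Z"
  have z: "z > 0" "Z = ennreal z"
    using Z0 Zinf by (auto simp: z_def enn2real_positive_iff less_top zero_less_iff_neq_zero)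
  have d: "exp_family_density M S \<eta> y = exp (S y \<bullet> \<eta>) * (1 / z)" for y
    using z Z0 Zinf
    by (simp add: exp_family_density_def log_partition_def ennreal_ln_def Z_def[symmetric] exp_diff
        del: ennreal_eq_zero_iff)
  have "ennreal (exp_family_density M S \<eta> y) = ennreal (exp (S y \<bullet> \<eta>)) * ennreal (1 / z)" for y
    unfolding d by (rule ennreal_mult') simp
  then have "(\<integral>\<^sup>+ y. ennreal (exp_family_density M S \<eta> y) \<partial>M) = Z * ennreal (1 / z)"
    by (simp add: nn_integral_multc Z_def del: times_divide_eq_right)
  also have "\<dots> = 1"
    using z by (simp flip: ennreal_mult')
  finally show ?thesis
    by (intro prob_spaceI) (simp add: emeasure_density d cong: nn_integral_cong)
qed

end

(* With A the log-partition function, p ln (p / q_eta) is p times an affine function of eta plus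
   p A(eta), so everything reduces to convexity of A, which follows by integrating the pointwise
   bound exp (u a + v b) <= u exp a + v exp b at normalised exponents. Since KL may be infinite,
   the pointwise inequality between the integrands is integrated after moving all negative parts,
   whose integrals are at most 1, to the other side. *)
theory Submission
  imports Defs
begin

lemma exp_family_density_pos: "exp_family_density M S \<eta> y > 0"
  by (simp add: exp_family_density_def)

lemma borel_measurable_exp_family_density [measurable]:
  assumes [measurable]: "S \<in> borel_measurable M"
  shows "exp_family_density M S \<eta> \<in> borel_measurable M"
  unfolding exp_family_density_def by measurable

text \<open>\<open>ennreal_ln\<close> takes the value infinity only at infinity, so finiteness of A
  can be read off the integral itself.\<close>

lemma mem_natural_parameter_space_iff:
  "\<eta> \<in> natural_parameter_space M S \<longleftrightarrow> (\<integral>\<^sup>+ y. ennreal (exp (S y \<bullet> \<eta>)) \<partial>M) < \<infinity>"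
  by (auto simp: natural_parameter_space_def log_partition_def ennreal_ln_def less_top)

lemma nn_integral_exp_family_density:
  assumes [measurable]: "S \<in> borel_measurable M" and "emeasure M (space M) \<noteq> 0"
    and "\<eta> \<in> natural_parameter_space M S"
  shows "(\<integral>\<^sup>+ y. ennreal (exp_family_density M S \<eta> y) \<partial>M) = 1"
  using prob_space.emeasure_space_1[OF prob_space_exp_family_density[OF assms]]
  by (simp add: emeasure_density cong: nn_integral_cong)

text \<open>The integrand is exp(A) times the density, and the density has total mass 1. This turns
  bounds on the integral into bounds on the real number A.\<close>

lemma nn_integral_exp_inner:
  assumes [measurable]: "S \<in> borel_measurable M" and "emeasure M (space M) \<noteq> 0"
    and "\<eta> \<in> natural_parameter_space M S"
  shows "(\<integral>\<^sup>+ y. ennreal (exp (S y \<bullet> \<eta>)) \<partial>M) = ennreal (exp (real_of_ereal (log_partition M S \<eta>)))"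
proof -
  let ?A = "real_of_ereal (log_partition M S \<eta>)"
  have "ennreal (exp (S y \<bullet> \<eta>)) = ennreal (exp ?A) * ennreal (exp_family_density M S \<eta> y)" for y
    by (simp add: exp_family_density_def flip: ennreal_mult' exp_add)
  then show ?thesis
    by (simp add: nn_integral_cmult nn_integral_exp_family_density[OF assms])
qed

text \<open>This is Hoelder's inequality Z(u a + v b) <= Z(a)^u Z(b)^v for Z = exp A, with
  \<open>c\<close> the logarithm of the right side. One bound on the integral serves both claims:
  its finiteness gives membership, and comparing exponents gives the inequality.\<close>

lemma log_partition_convex:
  assumes S [measurable]: "S \<in> borel_measurable M" and M: "emeasure M (space M) \<noteq> 0"
    and a: "a \<in> natural_parameter_space M S" and b: "b \<in> natural_parameter_space M S"
    and uv: "u \<ge> 0" "v \<ge> 0" "u + v = 1"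
  shows "u *\<^sub>R a + v *\<^sub>R b \<in> natural_parameter_space M S"
    and "real_of_ereal (log_partition M S (u *\<^sub>R a + v *\<^sub>R b))
      \<le> u * real_of_ereal (log_partition M S a) + v * real_of_ereal (log_partition M S b)"
proof -
  let ?A = "\<lambda>\<eta>. real_of_ereal (log_partition M S \<eta>)"
  let ?q = "exp_family_density M S"
  define c where "c = u * ?A a + v * ?A b"
  \<comment> \<open>Since \<open>?q a\<close> and \<open>?q b\<close> have mass 1 and u + v = 1, the
    right-hand side integrates to exactly exp c.\<close>
  have pw: "exp (S y \<bullet> (u *\<^sub>R a + v *\<^sub>R b)) \<le> exp c * (u * ?q a y + v * ?q b y)" for y
  proof -
    have "exp (u * (S y \<bullet> a - ?A a) + v * (S y \<bullet> b - ?A b)) \<le> u * ?q a y + v * ?q b y"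
      \<comment> \<open>\<open>convex_onD\<close> has the single weight v and writes the other as 1
        - v; \<open>eq_diff_eq\<close> brings u + v = 1 into that shape.\<close>
      using convex_onD[OF exp_convex, of v "S y \<bullet> a - ?A a" "S y \<bullet> b - ?A b"] uv
      by (simp add: exp_family_density_def eq_diff_eq[symmetric])
    then have "exp c * exp (u * (S y \<bullet> a - ?A a) + v * (S y \<bullet> b - ?A b))
        \<le> exp c * (u * ?q a y + v * ?q b y)"
      by (intro mult_left_mono) auto
    then show ?thesis
      by (simp add: c_def inner_add_right algebra_simps flip: exp_add)
  qed
  have "(\<integral>\<^sup>+ y. ennreal (exp (S y \<bullet> (u *\<^sub>R a + v *\<^sub>R b))) \<partial>M)
      \<le> (\<integral>\<^sup>+ y. ennreal (exp c) * (ennreal u * ennreal (?q a y) + ennreal v * ennreal (?q b y)) \<partial>M)"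
    using pw uv
    by (intro nn_integral_mono)
      (simp add: exp_family_density_pos less_imp_le flip: ennreal_mult ennreal_plus)
  also have "\<dots> = ennreal (exp c) * (ennreal u + ennreal v)"
    by (simp add: nn_integral_cmult nn_integral_add nn_integral_exp_family_density[OF S M] a b)
  also have "\<dots> = ennreal (exp c)"
    using uv by (simp flip: ennreal_plus)
  finally have le: "(\<integral>\<^sup>+ y. ennreal (exp (S y \<bullet> (u *\<^sub>R a + v *\<^sub>R b))) \<partial>M) \<le> ennreal (exp c)" .
  then show mem: "u *\<^sub>R a + v *\<^sub>R b \<in> natural_parameter_space M S"
    unfolding mem_natural_parameter_space_iff by (rule le_less_trans) simp
  show "?A (u *\<^sub>R a + v *\<^sub>R b) \<le> u * ?A a + v * ?A b"
    using le unfolding nn_integral_exp_inner[OF S M mem] c_def by simp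
qed

text \<open>Positive parts may have infinite integral, so the pointwise bound is integrated in the
  subtraction-free form h+ + u f- + v g- <= h- + u f+ + v g+. The integrals of the negative parts
  are finite and can be moved back afterwards.\<close>

lemma extended_integral_convex_bound:
  fixes f g h :: "'a \<Rightarrow> real"
  assumes [measurable]: "f \<in> borel_measurable M" "g \<in> borel_measurable M" "h \<in> borel_measurable M"
    and fin: "(\<integral>\<^sup>+ y. ennreal (- f y) \<partial>M) < \<infinity>" "(\<integral>\<^sup>+ y. ennreal (- g y) \<partial>M) < \<infinity>"
      "(\<integral>\<^sup>+ y. ennreal (- h y) \<partial>M) < \<infinity>"
    and uv: "u \<ge> 0" "v \<ge> 0"
    and le: "\<And>y. h y \<le> u * f y + v * g y"
  defines "I \<equiv> \<lambda>f. enn2ereal (\<integral>\<^sup>+ y. ennreal (f y) \<partial>M) - enn2ereal (\<integral>\<^sup>+ y. ennreal (- f y) \<partial>M)"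
  shows "I h \<le> ereal u * I f + ereal v * I g"
proof -
  let ?P = "\<lambda>f. \<integral>\<^sup>+ y. ennreal (f y) \<partial>M" and ?N = "\<lambda>f. \<integral>\<^sup>+ y. ennreal (- f y) \<partial>M"
  have pw: "ennreal (h y) + (ennreal u * ennreal (- f y) + ennreal v * ennreal (- g y))
      \<le> ennreal (- h y) + (ennreal u * ennreal (f y) + ennreal v * ennreal (g y))" for y
  proof -
    have split: "t = max 0 t - max 0 (- t)" for t :: real by simp
    have "h y \<le> u * f y + v * g y" by (rule le)
    then have "max 0 (h y) - max 0 (- h y)
        \<le> u * (max 0 (f y) - max 0 (- f y)) + v * (max 0 (g y) - max 0 (- g y))"
      by (simp flip: split)
    then have "max 0 (h y) + (u * max 0 (- f y) + v * max 0 (- g y))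
        \<le> max 0 (- h y) + (u * max 0 (f y) + v * max 0 (g y))"
      by (simp add: algebra_simps)
    \<comment> \<open>\<open>ennreal\<close> truncates negative reals to 0. With the maxima kept
      explicit every argument is nonnegative, so \<open>ennreal\<close> commutes with the sums and
      products.\<close>
    then have "ennreal (max 0 (h y)) + (ennreal u * ennreal (max 0 (- f y)) + ennreal v * ennreal (max 0 (- g y)))
        \<le> ennreal (max 0 (- h y)) + (ennreal u * ennreal (max 0 (f y)) + ennreal v * ennreal (max 0 (g y)))"
      using uv by (simp del: ennreal_max_0 ennreal_max_0' flip: ennreal_mult ennreal_plus)
    then show ?thesis by (simp only: ennreal_max_0)
  qed
  have "?P h + (ennreal u * ?N f + ennreal v * ?N g)
      = (\<integral>\<^sup>+ y. ennreal (h y) + (ennreal u * ennreal (- f y) + ennreal v * ennreal (- g y)) \<partial>M)"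
    by (simp add: nn_integral_add nn_integral_cmult)
  also have "\<dots> \<le> (\<integral>\<^sup>+ y. ennreal (- h y) + (ennreal u * ennreal (f y) + ennreal v * ennreal (g y)) \<partial>M)"
    by (intro nn_integral_mono pw)
  also have "\<dots> = ?N h + (ennreal u * ?P f + ennreal v * ?P g)"
    by (simp add: nn_integral_add nn_integral_cmult)
  finally have main: "enn2ereal (?P h + (ennreal u * ?N f + ennreal v * ?N g))
      \<le> enn2ereal (?N h + (ennreal u * ?P f + ennreal v * ?P g))"
    by (simp add: less_eq_ennreal.rep_eq)
  obtain nf ng nh where n: "enn2ereal (?N f) = ereal nf" "enn2ereal (?N g) = ereal ng"
      "enn2ereal (?N h) = ereal nh"
    using fin by (metis enn2ereal_ennreal less_top_ennreal infinity_ennreal_def)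
  have "enn2ereal (?P f) \<ge> 0" "enn2ereal (?P g) \<ge> 0" "enn2ereal (?P h) \<ge> 0" by auto
  with main show ?thesis
    unfolding I_def plus_ennreal.rep_eq times_ennreal.rep_eq n enn2ereal_ennreal[OF uv(1)]
      enn2ereal_ennreal[OF uv(2)]
    using uv
    \<comment> \<open>An infinite integral with positive weight makes the right side infinite, while
      one with weight 0 contributes 0; hence the split on u = 0 and v = 0.\<close>
    by (cases "enn2ereal (?P f)"; cases "enn2ereal (?P g)"; cases "enn2ereal (?P h)";
        cases "u = 0"; cases "v = 0") (auto simp: algebra_simps)
qed

text \<open>Positivity keeps \<open>kl_integrand\<close> in its real-valued branch. The formula
  remains valid when the divergence is infinite.\<close>

lemma kl_div_pos_densities:
  assumes "\<And>y. p y > 0" "\<And>y. q y > 0"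
  shows "kl_div M p q = enn2ereal (\<integral>\<^sup>+ y. ennreal (p y * ln (p y / q y)) \<partial>M)
    - enn2ereal (\<integral>\<^sup>+ y. ennreal (- (p y * ln (p y / q y))) \<partial>M)"
proof -
  have "p y \<noteq> 0" "q y \<noteq> 0" for y
    using assms[of y] by simp_all
  then show ?thesis
    by (simp add: kl_div_def kl_integrand_def e2ennreal_ereal)
qed

text \<open>From ln t <= t - 1 at t = q / p one gets p ln (q / p) <= q - p. Integrated against a
  base measure for which q is a probability density, it bounds the negative part of the divergence
  by 1.\<close>

lemma kl_negative_part_le:
  fixes p q :: real
  assumes "p > 0" "q > 0"
  shows "- (p * ln (p / q)) \<le> q"
proof -
  have "- (p * ln (p / q)) = p * ln (q / p)"
    using assms by (simp add: ln_div algebra_simps)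
  also have "\<dots> \<le> p * (q / p - 1)"
    using assms by (intro mult_left_mono ln_le_minus_one) auto
  also have "\<dots> \<le> q"
    using assms by (simp add: field_simps)
  finally show ?thesis .
qed

theorem theorem1:
  fixes M :: "'a measure" and S :: "'a \<Rightarrow> 'b::euclidean_space" and \<eta>x :: 'b
  assumes "S \<in> borel_measurable M"
    and "emeasure M (space M) \<noteq> 0"
    and "\<eta>x \<in> natural_parameter_space M S"
  shows "ereal_convex_on (natural_parameter_space M S)
           (\<lambda>\<eta>z. kl_div M (exp_family_density M S \<eta>x) (exp_family_density M S \<eta>z))"
proof -
  note [measurable] = assms(1)
  let ?N = "natural_parameter_space M S"
  let ?A = "\<lambda>\<eta>. real_of_ereal (log_partition M S \<eta>)"
  let ?q = "exp_family_density M S"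
  define g where "g = (\<lambda>\<eta> y. ?q \<eta>x y * ln (?q \<eta>x y / ?q \<eta> y))"
  have g_meas [measurable]: "g \<eta> \<in> borel_measurable M" for \<eta>
    unfolding g_def by measurable
  \<comment> \<open>The log-ratio of two members of the family is a difference of exponents, so
    \<eta> enters through an affine term and A only.\<close>
  have g_eq: "g \<eta> y = ?q \<eta>x y * (S y \<bullet> \<eta>x - S y \<bullet> \<eta> - ?A \<eta>x + ?A \<eta>)" for \<eta> y
    by (simp add: g_def exp_family_density_def flip: exp_diff)
  have g_fin: "(\<integral>\<^sup>+ y. ennreal (- g \<eta> y) \<partial>M) < \<infinity>" if "\<eta> \<in> ?N" for \<eta>
  proof -
    have "(\<integral>\<^sup>+ y. ennreal (- g \<eta> y) \<partial>M) \<le> (\<integral>\<^sup>+ y. ennreal (?q \<eta> y) \<partial>M)"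
      unfolding g_def
      by (intro nn_integral_mono ennreal_leI kl_negative_part_le exp_family_density_pos)
    also have "\<dots> < \<infinity>"
      by (simp add: nn_integral_exp_family_density[OF assms(1,2) that])
    finally show ?thesis .
  qed
  have kl: "kl_div M (?q \<eta>x) (?q \<eta>)
      = enn2ereal (\<integral>\<^sup>+ y. ennreal (g \<eta> y) \<partial>M) - enn2ereal (\<integral>\<^sup>+ y. ennreal (- g \<eta> y) \<partial>M)" for \<eta>
    unfolding g_def by (intro kl_div_pos_densities exp_family_density_pos)
  note conv = log_partition_convex[OF assms(1,2)]
  show ?thesis
    unfolding ereal_convex_on_def
  proof (intro conjI ballI allI impI)
    show "convex ?N"
      unfolding convex_def using conv(1) by blast
  next
    fix a b and u v :: real
    assume ab: "a \<in> ?N" "b \<in> ?N" and uv: "0 \<le> u" "0 \<le> v" "u + v = 1"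
    let ?w = "u *\<^sub>R a + v *\<^sub>R b"
    have "g ?w y \<le> u * g a y + v * g b y" for y
    proof -
      have u: "u = 1 - v" using uv by simp
      have "S y \<bullet> \<eta>x - S y \<bullet> ?w - ?A \<eta>x + ?A ?w
          \<le> S y \<bullet> \<eta>x - S y \<bullet> ?w - ?A \<eta>x + (u * ?A a + v * ?A b)"
        using conv(2)[OF ab uv] by simp
      \<comment> \<open>Substituting u = 1 - v distributes the terms independent of a and b over the
        two weights.\<close>
      also have "\<dots> = u * (S y \<bullet> \<eta>x - S y \<bullet> a - ?A \<eta>x + ?A a)
          + v * (S y \<bullet> \<eta>x - S y \<bullet> b - ?A \<eta>x + ?A b)"
        unfolding u by (simp add: inner_add_right algebra_simps)
      finally have "?q \<eta>x y * (S y \<bullet> \<eta>x - S y \<bullet> ?w - ?A \<eta>x + ?A ?w)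
          \<le> ?q \<eta>x y * (u * (S y \<bullet> \<eta>x - S y \<bullet> a - ?A \<eta>x + ?A a)
          + v * (S y \<bullet> \<eta>x - S y \<bullet> b - ?A \<eta>x + ?A b))"
        by (intro mult_left_mono less_imp_le[OF exp_family_density_pos])
      then show ?thesis
        unfolding g_eq by (simp only: distrib_left mult.left_commute)
    qed
    \<comment> \<open>Finiteness of the negative part at \<open>?w\<close> rests on
      \<open>?w\<close> lying in the parameter space, which is \<open>conv(1)\<close>.\<close>
    then show "kl_div M (?q \<eta>x) (?q ?w)
        \<le> ereal u * kl_div M (?q \<eta>x) (?q a) + ereal v * kl_div M (?q \<eta>x) (?q b)"
      unfolding kl
      by (intro extended_integral_convex_bound g_meas g_fin conv(1) ab uv)
  qed
qed

end
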